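(* Let $f\in L^1[-\pi,\pi]$ with $f\ge 0$, and suppose $u$ and $v$ solve the Poisson problems $$-u''=f \ \text{ in } (-\pi,\pi),\qquad u(-\pi)=u(\pi)=0,$$ $$-v''=f^{\#} \ \text{ in } (-\pi,\pi),\qquad v(-\pi)=v(\pi)=0,$$ where $f^{\#}$ is the symmetric decreasing rearrangement of $f$. Then $$\int_{-\pi}^{\pi}\phi(u)\,dx\le\int_{-\pi}^{\pi}\phi(v)\,dx$$ for each increasing convex function $\phi:\mathbb{R}\to\mathbb{R}$.
   Context: Rearrangements: let $X\subseteq\mathbb{R}$ be a measurable set of finite length $|X|$ and $f\in L^1(X)$. The decreasing rearrangement $f^{\ast}:[0,|X|]\to[-\infty,+\infty]$ is defined by $f^{\ast}(0)=\operatorname{ess\,sup}_X f$, $f^{\ast}(t)=\inf\{s: |\{x\in X: s<f(x)\}|\le t\}$ for $t\in(0,|X|)$, and $f^{\ast}(|X|)=\operatorname{ess\,inf}_X f$. The symmetric decreasing rearrangement is $f^{\#}:[-\tfrac12|X|,\tfrac12|X|]\to[-\infty,+\infty]$, $f^{\#}(t)=f^{\ast}(2|t|)$. Here $X=[-\pi,\pi]$. Solutions: a solution of $-u''=f$ in $(-\pi,\pi)$ with the given boundary conditions means a function $u\in C^1[-\pi,\pi]$ such that $u'$ is absolutely continuous on $[-\pi,\pi]$, $-u''=f$ a.e. on $(-\pi,\pi)$, and the boundary conditions hold. "Increasing" means nondecreasing. *)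

theory Defs
  imports "HOL-Analysis.Analysis" "HOL-Probability.Essential_Supremum"
begin

text \<open>Absolute continuity on \<open>[a, b]\<close>: the members \<open>(c, d)\<close> of the finite set \<open>D\<close> stand for
  pairwise disjoint open subintervals of \<open>[a, b]\<close>.\<close>

definition absolutely_continuous_fun :: "real \<Rightarrow> real \<Rightarrow> (real \<Rightarrow> real) \<Rightarrow> bool" where
  "absolutely_continuous_fun a b w \<longleftrightarrow>
     (\<forall>\<epsilon>>0. \<exists>\<delta>>0. \<forall>D :: (real \<times> real) set.
        finite D \<longrightarrow>
        (\<forall>(c, d)\<in>D. a \<le> c \<and> c < d \<and> d \<le> b) \<longrightarrow>
        disjoint_family_on (\<lambda>(c, d). {c<..<d}) D \<longrightarrow>
        (\<Sum>(c, d)\<in>D. d - c) < \<delta> \<longrightarrow>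
        (\<Sum>(c, d)\<in>D. \<bar>w d - w c\<bar>) < \<epsilon>)"

text \<open>The first branch is the essential supremum and the second the essential infimum of \<open>f\<close>
  on \<open>X\<close>. The set \<open>X\<close> is meant to have finite measure, and only arguments
  \<open>0 \<le> t \<le> measure lebesgue X\<close> are meaningful.\<close>

definition decreasing_rearrangement :: "real set \<Rightarrow> (real \<Rightarrow> real) \<Rightarrow> real \<Rightarrow> ereal" where
  "decreasing_rearrangement X f t =
     (if t = 0 then esssup (lebesgue_on X) (\<lambda>x. ereal (f x))
      else if t = measure lebesgue X then - esssup (lebesgue_on X) (\<lambda>x. - ereal (f x))
      else Inf (ereal ` {s. measure lebesgue {x \<in> X. s < f x} \<le> t}))"

definition symmetric_decreasing_rearrangement ::
    "real set \<Rightarrow> (real \<Rightarrow> real) \<Rightarrow> real \<Rightarrow> ereal" where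
  "symmetric_decreasing_rearrangement X f t = decreasing_rearrangement X f (2 * \<bar>t\<bar>)"

text \<open>A solution of \<open>- u'' = g\<close> in \<open>(a, b)\<close> with \<open>u(a) = u(b) = 0\<close>, where \<open>w\<close> is \<open>u'\<close> (one-sided
  at the end points). The right-hand side is extended real valued because a rearrangement may be
  infinite at single points.\<close>

definition solves_poisson_dirichlet ::
    "real \<Rightarrow> real \<Rightarrow> (real \<Rightarrow> ereal) \<Rightarrow> (real \<Rightarrow> real) \<Rightarrow> bool" where
  "solves_poisson_dirichlet a b g u \<longleftrightarrow>
     (\<exists>w. (\<forall>x\<in>{a..b}. (u has_real_derivative w x) (at x within {a..b})) \<and>
          continuous_on {a..b} w \<and>
          absolutely_continuous_fun a b w \<and>
          (AE x in lebesgue_on {a<..<b}.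
             \<exists>d. (w has_real_derivative d) (at x) \<and> ereal (- d) = g x)) \<and>
     u a = 0 \<and> u b = 0"

end

theory Submission
  imports Defs
begin

text \<open>The idea is to compare superlevel sets: for every level \<open>s\<close>, the set where \<open>\<phi> \<circ> u\<close> exceeds \<open>s\<close> is
  at most as long as the set where \<open>\<phi> \<circ> v\<close> does. Integrating over \<open>s\<close>
  (\<open>nn_integral_le_of_superlevel_le\<close>) then gives the theorem.

  Let \<open>a \<le> b\<close> be points of \<open>[-\<pi>, \<pi>]\<close>. The comparison of superlevel sets rests on the estimate
  \<open>min (u a) (u b) \<le> v ((b - a) / 2)\<close>. Given this estimate, two points \<open>a \<le> b\<close> with
  \<open>\<phi> (u a) > s\<close> and \<open>\<phi> (u b) > s\<close> force \<open>\<phi> (v ((b - a) / 2)) > s\<close>, because \<open>\<phi>\<close> is increasing. As \<open>v\<close> is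
  even and decreases away from \<open>0\<close>, this puts a whole centred interval of length \<open>b - a\<close> into the
  superlevel set of \<open>\<phi> \<circ> v\<close>, while a set of reals is never longer than its diameter.

  The estimate is obtained by letting \<open>[-\<pi>, \<pi>]\<close> shrink linearly to \<open>[a, b]\<close>
  (\<open>weighted_endpoint_comparison\<close>). A suitably weighted mean of the values of \<open>u\<close> at the two moving end
  points starts at \<open>0\<close> and grows at a rate proportional to the drop of \<open>u'\<close> over the current
  interval, which is the integral of \<open>f\<close>. The integral of \<open>f\<close> over an interval is at most that of
  its symmetric rearrangement over the centred interval of equal length
  (\<open>integral_le_integral_symmetric_decreasing_rearrangement\<close>), which is the drop of \<open>v'\<close> there and
  equals \<open>-2 v'\<close> at its right end point. By the inequality of arithmetic and geometric
  means, \<open>v\<close> at half the current length therefore grows at least as fast.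

  Turning drops of \<open>u'\<close> and \<open>v'\<close> into integrals uses the fundamental theorem of calculus for an
  absolutely continuous function (\<open>absolutely_continuous_fun_has_integral\<close>).\<close>

section \<open>The fundamental theorem of calculus for absolutely continuous functions\<close>

lemma sum_lengths_less_of_cover:
  fixes D :: "(real \<times> real) set"
  assumes "finite D" and less: "\<And>c d. (c, d) \<in> D \<Longrightarrow> c < d"
    and disj: "disjoint_family_on (\<lambda>(c, d). {c<..<d}) D"
    and sub: "\<And>c d. (c, d) \<in> D \<Longrightarrow> {c<..<d} \<subseteq> U"
    and U: "U \<in> sets lebesgue" "emeasure lebesgue U < ennreal \<delta>"
  shows "(\<Sum>(c, d)\<in>D. d - c) < \<delta>"
proof -
  have "ennreal (\<Sum>(c, d)\<in>D. d - c) = (\<Sum>p\<in>D. ennreal (case p of (c, d) \<Rightarrow> d - c))"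
    by (rule sum_ennreal[symmetric]) (use less in \<open>fastforce dest: less_imp_le\<close>)
  also have "\<dots> = (\<Sum>p\<in>D. emeasure lebesgue (case p of (c, d) \<Rightarrow> {c<..<d}))"
    using less by (intro sum.cong) (auto intro!: emeasure_lborel_Ioo[symmetric] less_imp_le)
  also have "\<dots> = emeasure lebesgue (\<Union>p\<in>D. case p of (c, d) \<Rightarrow> {c<..<d})"
    using assms(1) disj by (intro sum_emeasure) auto
  also have "\<dots> \<le> emeasure lebesgue U"
    using sub U by (intro emeasure_mono) auto
  also note U(2)
  finally show ?thesis
    by (meson ennreal_leI not_le)
qed

lemma absolutely_continuous_funE:
  assumes "absolutely_continuous_fun a b w" "\<epsilon> > 0"
  obtains \<delta> where "\<delta> > 0" and "\<And>D. finite D \<Longrightarrow>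
      (\<And>c d. (c, d)\<in>D \<Longrightarrow> a \<le> c \<and> c < d \<and> d \<le> b) \<Longrightarrow>
      disjoint_family_on (\<lambda>(c, d). {c<..<d}) D \<Longrightarrow> (\<Sum>(c, d)\<in>D. d - c) < \<delta> \<Longrightarrow>
      (\<Sum>(c, d)\<in>D. \<bar>w d - w c\<bar>) < \<epsilon>"
proof -
  from assms(1)[unfolded absolutely_continuous_fun_def, THEN spec, THEN mp, OF assms(2)]
  obtain \<delta> where "\<delta> > 0" and \<delta>: "\<forall>D. finite D \<longrightarrow>
        (\<forall>(c, d)\<in>D. a \<le> c \<and> c < d \<and> d \<le> b) \<longrightarrow>
        disjoint_family_on (\<lambda>(c, d). {c<..<d}) D \<longrightarrow>
        (\<Sum>(c, d)\<in>D. d - c) < \<delta> \<longrightarrow>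
        (\<Sum>(c, d)\<in>D. \<bar>w d - w c\<bar>) < \<epsilon>"
    by (elim exE conjE)
  show ?thesis
    by (rule that[OF \<open>\<delta> > 0\<close>], rule \<delta>[THEN spec, THEN mp, THEN mp, THEN mp, THEN mp])
       (assumption | rule ballI case_prodI2 | simp)+
qed

text \<open>A gauge argument proves this directly from differentiability outside a null set \<open>N\<close>. At a
  tag outside \<open>N\<close> the gauge is the one given by the derivative, so that these cells contribute an
  error of at most \<open>\<epsilon>\<close> times their length. At a tag in \<open>N\<close> the gauge is a fixed open set \<open>U\<close> around
  \<open>N\<close> of measure less than \<open>\<delta>\<close>: the cells with such tags are non-overlapping and inside \<open>U\<close>, so
  absolute continuity makes the total increment of \<open>w\<close> over them small.\<close>

lemma absolutely_continuous_fun_has_integral: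
  fixes w g :: "real \<Rightarrow> real"
  assumes "a \<le> b" and ac: "absolutely_continuous_fun a b w" and N: "negligible N"
    and der: "\<And>x. x \<in> {a..b} - N \<Longrightarrow> (w has_real_derivative g x) (at x within {a..b})"
  shows "(g has_integral w b - w a) {a..b}"
proof (cases "a = b")
  case True
  then show ?thesis using has_integral_refl(2)[of g a] by simp
next
  case False
  with \<open>a \<le> b\<close> have "a < b" by simp
  define g0 where "g0 x = (if x \<in> N then 0 else g x)" for x
  have "(g0 has_integral w b - w a) (cbox a b)"
    unfolding has_integral
  proof (intro allI impI)
    fix e :: real
    assume "e > 0"
    define \<epsilon> where "\<epsilon> = e / (2 * (b - a))"
    have "\<epsilon> > 0" using \<open>e > 0\<close> \<open>a < b\<close> by (simp add: \<epsilon>_def)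
    have "\<forall>x. \<exists>r>0. x \<in> {a..b} - N \<longrightarrow>
         (\<forall>y\<in>{a..b}. \<bar>y - x\<bar> < r \<longrightarrow> \<bar>w y - w x - (y - x) * g x\<bar> \<le> \<epsilon> * \<bar>y - x\<bar>)"
    proof
      fix x
      show "\<exists>r>0. x \<in> {a..b} - N \<longrightarrow>
         (\<forall>y\<in>{a..b}. \<bar>y - x\<bar> < r \<longrightarrow> \<bar>w y - w x - (y - x) * g x\<bar> \<le> \<epsilon> * \<bar>y - x\<bar>)"
      proof (cases "x \<in> {a..b} - N")
        case True
        from der[OF this] have "(w has_derivative (*) (g x)) (at x within {a..b})"
          by (simp add: has_field_derivative_def)
        with \<open>\<epsilon> > 0\<close> obtain r where "r > 0"
          "\<forall>y\<in>{a..b}. norm (y - x) < r \<longrightarrow> norm (w y - w x - g x * (y - x)) \<le> \<epsilon> * norm (y - x)"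
          unfolding has_derivative_within_alt by blast
        then show ?thesis by (intro exI[of _ r]) (simp add: mult.commute)
      qed (auto intro: exI[of _ 1])
    qed
    then obtain r where r: "\<And>x. r x > 0"
      "\<And>x y. x \<in> {a..b} - N \<Longrightarrow> y \<in> {a..b} \<Longrightarrow> \<bar>y - x\<bar> < r x \<Longrightarrow>
         \<bar>w y - w x - (y - x) * g x\<bar> \<le> \<epsilon> * \<bar>y - x\<bar>"
      by metis
    obtain \<delta> where "\<delta> > 0" and \<delta>: "\<And>D. finite D \<Longrightarrow> (\<And>c d. (c, d)\<in>D \<Longrightarrow> a \<le> c \<and> c < d \<and> d \<le> b) \<Longrightarrow>
        disjoint_family_on (\<lambda>(c, d). {c<..<d}) D \<Longrightarrow> (\<Sum>(c, d)\<in>D. d - c) < \<delta> \<Longrightarrow>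
        (\<Sum>(c, d)\<in>D. \<bar>w d - w c\<bar>) < e / 2"
      using absolutely_continuous_funE[OF ac, of "e / 2"] \<open>e > 0\<close> half_gt_zero by metis
    have "N \<in> sets lebesgue" "emeasure lebesgue N = 0"
      using N by (auto simp: negligible_iff_null_sets null_sets_def)
    then obtain U where U: "open U" "N \<subseteq> U" "U - N \<in> lmeasurable"
        "emeasure lebesgue (U - N) < ennreal \<delta>"
      using sets_lebesgue_outer_open \<open>\<delta> > 0\<close> by blast
    have "emeasure lebesgue (U - N) = emeasure lebesgue U"
      using U N by (intro emeasure_Diff_null_set) (auto simp: negligible_iff_null_sets)
    with U have U_less: "emeasure lebesgue U < ennreal \<delta>" by simp
    define \<gamma> where "\<gamma> x = (if x \<in> N then U else ball x (r x))" for x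
    show "\<exists>\<gamma>. gauge \<gamma> \<and> (\<forall>p. p tagged_division_of cbox a b \<and> \<gamma> fine p \<longrightarrow>
        norm ((\<Sum>(x, k)\<in>p. measure lborel k *\<^sub>R g0 x) - (w b - w a)) < e)"
    proof (intro exI[of _ \<gamma>] conjI allI impI)
      show "gauge \<gamma>"
        using U r(1) by (auto simp: gauge_def \<gamma>_def)
    next
      fix p
      assume "p tagged_division_of cbox a b \<and> \<gamma> fine p"
      then have p: "p tagged_division_of cbox a b" "\<gamma> fine p" by auto
      have fin: "finite p" using p by blast
      have K: "\<exists>c d. K = {c..d} \<and> c \<le> x \<and> x \<le> d \<and> a \<le> c \<and> d \<le> b \<and> Inf K = c \<and> Sup K = d"
        if xK: "(x, K) \<in> p" for x K
      proof -
        obtain c d where cd: "K = cbox c d" using tagged_division_ofD(4)[OF p(1) xK] by blast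
        have "x \<in> K" "K \<subseteq> cbox a b" using tagged_division_ofD(2,3)[OF p(1) xK] by auto
        then show ?thesis using cd by (intro exI[of _ c] exI[of _ d]) auto
      qed
      define \<Delta> where "\<Delta> = (\<lambda>(x, K). measure lborel K * g0 x - (w (Sup K) - w (Inf K)))"
      have len: "Inf K \<le> Sup K" if "(x, K) \<in> p" for x K
        using K[OF that] by auto
      have tel: "(\<Sum>(x, K)\<in>p. h (Sup K) - h (Inf K)) = h b - h a" for h :: "real \<Rightarrow> real"
        using additive_tagged_division_1[OF \<open>a \<le> b\<close>, of p h] p by simp
      have eq: "(\<Sum>(x, k)\<in>p. measure lborel k *\<^sub>R g0 x) - (w b - w a) = sum \<Delta> p"
        unfolding tel[of w, symmetric] by (simp add: \<Delta>_def sum_subtractf case_prod_unfold)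
      have split: "sum \<Delta> p = sum \<Delta> {q\<in>p. fst q \<notin> N} + sum \<Delta> {q\<in>p. fst q \<in> N}"
        using fin by (subst sum.union_disjoint[symmetric]) (auto intro: sum.cong)
      have "\<bar>sum \<Delta> {q\<in>p. fst q \<notin> N}\<bar> \<le> (\<Sum>(x, K)\<in>{q\<in>p. fst q \<notin> N}. \<epsilon> * (Sup K - Inf K))"
      proof (rule order.trans[OF sum_abs], rule sum_mono, safe)
        fix x K assume xK: "(x, K) \<in> p" "fst (x, K) \<notin> N"
        obtain c d where cd: "K = {c..d}" "c \<le> x" "x \<le> d" "a \<le> c" "d \<le> b" "Inf K = c" "Sup K = d"
          using K[OF xK(1)] by blast
        have "K \<subseteq> ball x (r x)" using fineD[OF p(2) xK(1)] xK(2) by (simp add: \<gamma>_def)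
        then have "\<bar>c - x\<bar> < r x" "\<bar>d - x\<bar> < r x"
          using cd by (force simp: dist_real_def abs_minus_commute)+
        then have "\<bar>w c - w x - (c - x) * g x\<bar> \<le> \<epsilon> * \<bar>c - x\<bar>" "\<bar>w d - w x - (d - x) * g x\<bar> \<le> \<epsilon> * \<bar>d - x\<bar>"
          using r(2)[of x c] r(2)[of x d] cd xK by auto
        then show "\<bar>\<Delta> (x, K)\<bar> \<le> \<epsilon> * (Sup K - Inf K)"
          using cd xK by (simp add: \<Delta>_def g0_def abs_le_iff algebra_simps)
      qed
      also have "\<dots> \<le> (\<Sum>(x, K)\<in>p. \<epsilon> * (Sup K - Inf K))"
        using fin \<open>\<epsilon> > 0\<close> len by (intro sum_mono2) (auto intro!: mult_nonneg_nonneg)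
      also have "\<dots> = \<epsilon> * (\<Sum>(x, K)\<in>p. Sup K - Inf K)"
        by (simp add: sum_distrib_left case_prod_unfold)
      also have "\<dots> = e / 2"
        unfolding tel[of "\<lambda>x. x"] using \<open>a < b\<close> by (simp add: \<epsilon>_def field_simps)
      finally have good: "\<bar>sum \<Delta> {q\<in>p. fst q \<notin> N}\<bar> \<le> e / 2" .
      \<comment> \<open>Degenerate cells carry no increment. They are discarded because the definition of absolute
        continuity only admits nonempty open intervals, and because without them a cell is determined
        by its end points.\<close>
      define P where "P = {q\<in>p. fst q \<in> N \<and> Inf (snd q) < Sup (snd q)}"
      define ends :: "real \<times> real set \<Rightarrow> real \<times> real" where "ends q = (Inf (snd q), Sup (snd q))" for q
      have disj: "{Inf K<..<Sup K} \<inter> {Inf K'<..<Sup K'} = {}"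
        if "(x, K) \<in> p" "(x', K') \<in> p" "(x, K) \<noteq> (x', K')" for x K x' K'
      proof -
        have "interior K \<inter> interior K' = {}" using tagged_division_ofD(5)[OF p(1) that] .
        then show ?thesis using K[OF that(1)] K[OF that(2)] by force
      qed
      have inj: "inj_on ends P"
      proof (rule inj_onI)
        fix q q' assume q: "q \<in> P" "q' \<in> P" "ends q = ends q'"
        then have "{Inf (snd q)<..<Sup (snd q)} \<inter> {Inf (snd q')<..<Sup (snd q')} \<noteq> {}"
          by (auto simp: ends_def P_def)
        then show "q = q'" using disj[of "fst q" "snd q" "fst q'" "snd q'"] q by (auto simp: P_def)
      qed
      have "\<bar>sum \<Delta> {q\<in>p. fst q \<in> N}\<bar> \<le> (\<Sum>q\<in>{q\<in>p. fst q \<in> N}. \<bar>w (Sup (snd q)) - w (Inf (snd q))\<bar>)"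
        by (rule order.trans[OF sum_abs], rule sum_mono) (auto simp: \<Delta>_def g0_def)
      also have "\<dots> = (\<Sum>q\<in>P. \<bar>w (Sup (snd q)) - w (Inf (snd q))\<bar>)"
      proof (rule sum.mono_neutral_right)
        show "\<forall>q\<in>{q \<in> p. fst q \<in> N} - P. \<bar>w (Sup (snd q)) - w (Inf (snd q))\<bar> = 0"
        proof
          fix q assume q: "q \<in> {q \<in> p. fst q \<in> N} - P"
          then have "Inf (snd q) \<le> Sup (snd q)" using len[of "fst q" "snd q"] by auto
          with q show "\<bar>w (Sup (snd q)) - w (Inf (snd q))\<bar> = 0" by (auto simp: P_def)
        qed
      qed (use fin in \<open>auto simp: P_def\<close>)
      also have "\<dots> = (\<Sum>(c, d)\<in>ends ` P. \<bar>w d - w c\<bar>)"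
        by (subst sum.reindex[OF inj]) (simp add: ends_def)
      also have "\<dots> < e / 2"
      proof (rule \<delta>)
        show 1: "finite (ends ` P)" using fin by (auto simp: P_def)
        show 2: "a \<le> c \<and> c < d \<and> d \<le> b" if "(c, d) \<in> ends ` P" for c d
          using that K by (fastforce simp: P_def ends_def)
        show 3: "disjoint_family_on (\<lambda>(c, d). {c<..<d}) (ends ` P)"
          using disj by (fastforce simp: disjoint_family_on_def P_def ends_def)
        show "(\<Sum>(c, d)\<in>ends ` P. d - c) < \<delta>"
        proof (rule sum_lengths_less_of_cover[OF 1 _ 3 _ _ U_less])
          show "{c<..<d} \<subseteq> U" if "(c, d) \<in> ends ` P" for c d
          proof -
            from that obtain x L where q: "(x, L) \<in> p" "x \<in> N" "c = Inf L" "d = Sup L"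
              by (auto simp: P_def ends_def)
            then have "L \<subseteq> U" using fineD[OF p(2) q(1)] by (simp add: \<gamma>_def)
            with K[OF q(1)] q show ?thesis by force
          qed
        qed (use 2 U in auto)
      qed
      finally have "\<bar>sum \<Delta> {q\<in>p. fst q \<in> N}\<bar> < e / 2" .
      with good show "norm ((\<Sum>(x, k)\<in>p. measure lborel k *\<^sub>R g0 x) - (w b - w a)) < e"
        unfolding eq split by simp
    qed
  qed
  then have "(g0 has_integral w b - w a) {a..b}" by simp
  then show ?thesis
    by (rule has_integral_spike[OF N, rotated]) (auto simp: g0_def)
qed

lemma absolutely_continuous_fun_subinterval:
  assumes "absolutely_continuous_fun a b w" "a \<le> c" "d \<le> b"
  shows "absolutely_continuous_fun c d w"
  unfolding absolutely_continuous_fun_def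
proof (intro allI impI)
  fix \<epsilon> :: real assume "\<epsilon> > 0"
  then obtain \<delta> where "\<delta> > 0" and \<delta>: "\<And>D. finite D \<Longrightarrow>
      (\<And>c d. (c, d)\<in>D \<Longrightarrow> a \<le> c \<and> c < d \<and> d \<le> b) \<Longrightarrow>
      disjoint_family_on (\<lambda>(c, d). {c<..<d}) D \<Longrightarrow> (\<Sum>(c, d)\<in>D. d - c) < \<delta> \<Longrightarrow>
      (\<Sum>(c, d)\<in>D. \<bar>w d - w c\<bar>) < \<epsilon>"
    using absolutely_continuous_funE[OF assms(1)] by metis
  show "\<exists>\<delta>>0. \<forall>D. finite D \<longrightarrow>
        (\<forall>(s, t)\<in>D. c \<le> s \<and> s < t \<and> t \<le> d) \<longrightarrow>
        disjoint_family_on (\<lambda>(c, d). {c<..<d}) D \<longrightarrow>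
        (\<Sum>(c, d)\<in>D. d - c) < \<delta> \<longrightarrow>
        (\<Sum>(c, d)\<in>D. \<bar>w d - w c\<bar>) < \<epsilon>"
  proof (intro exI[of _ \<delta>] conjI allI impI \<open>\<delta> > 0\<close>)
    fix D :: "(real \<times> real) set"
    assume D: "finite D" "\<forall>(s, t)\<in>D. c \<le> s \<and> s < t \<and> t \<le> d"
      "disjoint_family_on (\<lambda>(c, d). {c<..<d}) D" "(\<Sum>(c, d)\<in>D. d - c) < \<delta>"
    show "(\<Sum>(c, d)\<in>D. \<bar>w d - w c\<bar>) < \<epsilon>"
    proof (rule \<delta>[OF D(1) _ D(3,4)])
      fix s t assume "(s, t) \<in> D"
      with D(2) have "c \<le> s \<and> s < t \<and> t \<le> d" by blast
      with assms show "a \<le> s \<and> s < t \<and> t \<le> b" by linarith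
    qed
  qed
qed

section \<open>Superlevel sets and the decreasing rearrangement\<close>
text \<open>The integral of \<open>max 0 f\<close> is the area below its graph; Tonelli's theorem slices this area
  horizontally.\<close>

lemma nn_integral_layer_cake:
  fixes f :: "'a \<Rightarrow> real"
  assumes "sigma_finite_measure M" and f [measurable]: "f \<in> borel_measurable M"
  shows "(\<integral>\<^sup>+x. ennreal (f x) \<partial>M) = (\<integral>\<^sup>+s. indicator {0..} s * emeasure M {x \<in> space M. s < f x} \<partial>lborel)"
proof -
  interpret M: sigma_finite_measure M by fact
  interpret pair_sigma_finite M lborel by unfold_locales
  define E where "E = {p \<in> space (M \<Otimes>\<^sub>M lborel). 0 \<le> snd p \<and> snd p < f (fst p)}"
  have [measurable]: "E \<in> sets (M \<Otimes>\<^sub>M lborel)" unfolding E_def by measurable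
  have "(\<integral>\<^sup>+x. ennreal (f x) \<partial>M) = (\<integral>\<^sup>+x. (\<integral>\<^sup>+s. indicator E (x, s) \<partial>lborel) \<partial>M)"
  proof (rule nn_integral_cong)
    fix x assume x: "x \<in> space M"
    have "(\<integral>\<^sup>+s. indicator E (x, s) \<partial>lborel) = (\<integral>\<^sup>+s. indicator {0..<f x} s \<partial>lborel)"
      using x by (intro nn_integral_cong) (auto simp: E_def space_pair_measure indicator_def)
    also have "\<dots> = ennreal (f x)"
      by (cases "f x \<ge> 0") (auto simp: ennreal_neg)
    finally show "ennreal (f x) = (\<integral>\<^sup>+s. indicator E (x, s) \<partial>lborel)" ..
  qed
  also have "\<dots> = (\<integral>\<^sup>+s. (\<integral>\<^sup>+x. indicator E (x, s) \<partial>M) \<partial>lborel)"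
    by (rule Fubini'[symmetric]) measurable
  also have "\<dots> = (\<integral>\<^sup>+s. indicator {0..} s * emeasure M {x \<in> space M. s < f x} \<partial>lborel)"
  proof (rule nn_integral_cong)
    fix s :: real
    have "(\<integral>\<^sup>+x. indicator E (x, s) \<partial>M)
        = (\<integral>\<^sup>+x. indicator {0..} s * indicator {x \<in> space M. s < f x} x \<partial>M)"
      by (intro nn_integral_cong) (auto simp: E_def space_pair_measure indicator_def)
    also have "\<dots> = indicator {0..} s * emeasure M {x \<in> space M. s < f x}"
      by (subst nn_integral_cmult_indicator) auto
    finally show "(\<integral>\<^sup>+x. indicator E (x, s) \<partial>M)
        = indicator {0..} s * emeasure M {x \<in> space M. s < f x}" .
  qed
  finally show ?thesis .
qed

text \<open>Both comparisons of integrals below, that of \<open>f\<close> with its rearrangement and that of \<open>\<phi> \<circ> u\<close>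
  with \<open>\<phi> \<circ> v\<close>, are reduced by this corollary to a comparison of lengths of superlevel sets.\<close>

corollary nn_integral_le_of_superlevel_le:
  fixes f :: "'a \<Rightarrow> real" and g :: "'b \<Rightarrow> real"
  assumes "sigma_finite_measure M" "sigma_finite_measure N"
    and "f \<in> borel_measurable M" "g \<in> borel_measurable N"
    and "\<And>s. s \<ge> 0 \<Longrightarrow> emeasure M {x \<in> space M. s < f x} \<le> emeasure N {x \<in> space N. s < g x}"
  shows "(\<integral>\<^sup>+x. ennreal (f x) \<partial>M) \<le> (\<integral>\<^sup>+x. ennreal (g x) \<partial>N)"
  unfolding nn_integral_layer_cake[OF assms(1,3)] nn_integral_layer_cake[OF assms(2,4)]
  using assms(5) by (intro nn_integral_mono) (auto simp: indicator_def)

lemma lmeasurable_superlevel: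
  fixes f :: "'a::euclidean_space \<Rightarrow> real"
  assumes X: "X \<in> lmeasurable" and f: "f \<in> borel_measurable (lebesgue_on X)"
  shows "{x \<in> X. s < f x} \<in> lmeasurable"
proof -
  have "{x \<in> space (lebesgue_on X). s < f x} \<in> sets (lebesgue_on X)"
    using f by measurable
  then have "{x \<in> X. s < f x} \<in> sets lebesgue"
    using X by (auto simp: sets_restrict_space_iff fmeasurableD)
  then show ?thesis by (rule fmeasurableI2[OF X, rotated]) auto
qed

text \<open>The distribution function \<open>s \<mapsto> |{f > s}|\<close> is continuous from the right. A strict inequality
  \<open>t < |{f > s}|\<close> therefore persists for a slightly larger level, and this larger level is a lower
  bound for the infimum that defines the rearrangement.\<close>

lemma decreasing_rearrangement_greater:
  assumes X: "X \<in> lmeasurable" and f: "f \<in> borel_measurable (lebesgue_on X)"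
    and t: "0 < t" "t < measure lebesgue X" "t < measure lebesgue {x \<in> X. s < f x}"
  shows "ereal s < decreasing_rearrangement X f t"
proof -
  note lm = lmeasurable_superlevel[OF X f]
  define A where "A n = {x \<in> X. s + 1 / real (Suc n) < f x}" for n
  have "incseq A"
  proof (rule incseq_SucI, safe)
    fix n x assume "x \<in> A n"
    moreover have "1 / real (Suc (Suc n)) \<le> 1 / real (Suc n)" by (simp add: field_simps)
    ultimately show "x \<in> A (Suc n)" unfolding A_def by auto
  qed
  have UN: "(\<Union>n. A n) = {x \<in> X. s < f x}"
  proof safe
    fix x assume "x \<in> X" "s < f x"
    then obtain n where "1 / real (Suc n) < f x - s"
      using nat_approx_posE[of "f x - s"] by auto
    with \<open>x \<in> X\<close> show "x \<in> (\<Union>n. A n)" by (auto simp: A_def intro!: exI[of _ n])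
  next
    fix n x assume "x \<in> A n"
    moreover have "0 < 1 / real (Suc n)" by simp
    ultimately show "x \<in> X" "s < f x" unfolding A_def by (simp, smt (verit) mem_Collect_eq)
  qed
  have "(\<lambda>n. measure lebesgue (A n)) \<longlonglongrightarrow> measure lebesgue (\<Union>n. A n)"
  proof (rule Lim_measure_incseq[OF _ \<open>incseq A\<close>])
    show "range A \<subseteq> sets lebesgue" using lm by (auto simp: A_def)
    show "emeasure lebesgue (\<Union>n. A n) \<noteq> \<infinity>"
      unfolding UN using fmeasurableD2[OF lm] by (simp only: infinity_ennreal_def not_False_eq_True)
  qed
  from order_tendstoD(1)[OF this[unfolded UN] t(3)]
  have "eventually (\<lambda>n. t < measure lebesgue (A n)) sequentially" .
  then obtain n where n: "t < measure lebesgue (A n)"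
    by (auto simp: eventually_sequentially)
  have "ereal (s + 1 / real (Suc n)) \<le> Inf (ereal ` {s. measure lebesgue {x \<in> X. s < f x} \<le> t})"
  proof (rule Inf_greatest)
    fix y assume "y \<in> ereal ` {s. measure lebesgue {x \<in> X. s < f x} \<le> t}"
    then obtain s' where y: "y = ereal s'" and s': "measure lebesgue {x \<in> X. s' < f x} \<le> t" by auto
    have "s + 1 / real (Suc n) \<le> s'"
    proof (rule ccontr)
      assume "\<not> s + 1 / real (Suc n) \<le> s'"
      then have "A n \<subseteq> {x \<in> X. s' < f x}" by (auto simp: A_def)
      then have "measure lebesgue (A n) \<le> measure lebesgue {x \<in> X. s' < f x}"
        using lm by (intro measure_mono_fmeasurable) (auto simp: A_def)
      with n s' show False by simp
    qed
    then show "ereal (s + 1 / real (Suc n)) \<le> y" by (simp add: y)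
  qed
  moreover have "ereal s < ereal (s + 1 / real (Suc n))" by simp
  ultimately have "ereal s < Inf (ereal ` {s. measure lebesgue {x \<in> X. s < f x} \<le> t})"
    by (rule less_le_trans[rotated])
  then show ?thesis
    using t by (simp add: decreasing_rearrangement_def)
qed

text \<open>For a negative level \<open>s\<close> the set \<open>{f > s}\<close> has full measure, which exceeds \<open>t\<close>, so the
  infimum that defines the rearrangement only ranges over nonnegative levels.\<close>

lemma decreasing_rearrangement_nonneg:
  assumes X: "X \<in> lmeasurable" and f: "f \<in> borel_measurable (lebesgue_on X)"
    and nonneg: "AE x in lebesgue_on X. 0 \<le> f x"
    and t: "0 < t" "t < measure lebesgue X"
  shows "0 \<le> decreasing_rearrangement X f t"
proof -
  have ae: "AE x in lebesgue. x \<in> X \<longrightarrow> 0 \<le> f x"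
    using nonneg X by (subst (asm) AE_restrict_space_iff) (auto simp: fmeasurableD)
  have "0 \<le> Inf (ereal ` {s. measure lebesgue {x \<in> X. s < f x} \<le> t})"
  proof (rule Inf_greatest)
    fix y assume "y \<in> ereal ` {s. measure lebesgue {x \<in> X. s < f x} \<le> t}"
    then obtain s where y: "y = ereal s" and s: "measure lebesgue {x \<in> X. s < f x} \<le> t" by auto
    have "0 \<le> s"
    proof (rule ccontr)
      assume "\<not> 0 \<le> s"
      have "measure lebesgue {x \<in> X. s < f x} = measure lebesgue X"
        using ae X lmeasurable_superlevel[OF X f, of s] \<open>\<not> 0 \<le> s\<close>
        by (intro measure_eq_AE) (auto elim!: eventually_mono)
      with s t show False by simp
    qed
    then show "0 \<le> y" by (simp add: y)
  qed
  then show ?thesis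
    using t by (auto simp: decreasing_rearrangement_def)
qed

text \<open>If \<open>{f > s}\<close> meets \<open>[c, d]\<close> in a set of measure \<open>m\<close>, then \<open>m \<le> d - c\<close> and \<open>m \<le> |{f > s}|\<close>, so the
  rearrangement exceeds \<open>s\<close> on the centred interval of length \<open>m\<close>, which lies in the centred interval
  of length \<open>d - c\<close>. Slicing both integrals horizontally turns this into
  an inequality between them.

  The finiteness assumption makes \<open>real_of_ereal\<close> harmless: it would send an infinite value to \<open>0\<close>.\<close>

lemma integral_le_integral_symmetric_decreasing_rearrangement:
  fixes f :: "real \<Rightarrow> real" and p :: real
  defines "g \<equiv> (\<lambda>x. real_of_ereal (symmetric_decreasing_rearrangement {-p..p} f x))"
  assumes f: "f \<in> borel_measurable (lebesgue_on {-p..p})"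
    and nonneg: "AE x in lebesgue_on {-p..p}. 0 \<le> f x"
    and finite: "AE x in lebesgue_on {-p<..<p}.
                   \<bar>symmetric_decreasing_rearrangement {-p..p} f x\<bar> \<noteq> \<infinity>"
    and cd: "-p \<le> c" "c \<le> d" "d \<le> p"
    and I: "(f has_integral I) {c..d}"
    and J: "(g has_integral J) {-((d - c) / 2)..(d - c) / 2}"
  shows "I \<le> J" and "0 \<le> J"
proof -
  define r where "r = (d - c) / 2"
  have r: "0 \<le> r" "r \<le> p" "d - c = 2 * r" using cd by (auto simp: r_def)
  note J = J[folded r_def]
  have X: "{-p..p} \<in> lmeasurable" "measure lebesgue {-p..p} = 2 * p" using cd by auto
  have aef: "AE x in lebesgue. x \<in> {-p..p} \<longrightarrow> 0 \<le> f x"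
    using nonneg by (subst (asm) AE_restrict_space_iff) auto
  \<comment> \<open>Positive parts: equal to \<open>f\<close> and \<open>g\<close> almost everywhere, and nonnegative without exception, as the
    conversion between the gauge integral and the Lebesgue integral requires.\<close>
  define f' g' where "f' x = max 0 (f x)" and "g' x = max 0 (g x)" for x
  have "negligible {x. \<not> (x \<in> {-p..p} \<longrightarrow> 0 \<le> f x)}"
    using aef by (simp add: negligible_iff_null_sets completion.AE_iff_null_sets)
  then have I': "(f' has_integral I) {c..d}"
    by (rule has_integral_spike[OF _ _ I]) (use cd in \<open>auto simp: f'_def\<close>)
  have pos: "0 \<le> symmetric_decreasing_rearrangement {-p..p} f x" if "x \<noteq> 0" "\<bar>x\<bar> < p" for x
    unfolding symmetric_decreasing_rearrangement_def
    by (rule decreasing_rearrangement_nonneg[OF X(1) f nonneg]) (use X that in auto)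
  \<comment> \<open>At these points the rearrangement is given by the separate clauses for essential bounds.\<close>
  have "negligible {0, -p, p}" by (intro negligible_finite) auto
  then have J': "(g' has_integral J) {-r..r}"
  proof (rule has_integral_spike[OF _ _ J])
    fix x assume "x \<in> {-r..r} - {0, -p, p}"
    then have "x \<noteq> 0" "\<bar>x\<bar> < p" using r by auto
    from pos[OF this] show "g' x = g x" by (simp add: g'_def g_def real_of_ereal_pos)
  qed
  have f'm: "f' \<in> borel_measurable (lebesgue_on {c..d})"
    using I' by (intro integrable_imp_measurable) blast
  have g'm: "g' \<in> borel_measurable (lebesgue_on {-r..r})"
    using J' by (intro integrable_imp_measurable) blast
  have sf: "sigma_finite_measure (lebesgue_on {a..b})" for a b :: real
    using finite_measure_lebesgue_on[of "{a..b}"] finite_measure.axioms(1) by auto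
  have nnI: "(\<integral>\<^sup>+x. ennreal (h x) \<partial>lebesgue_on {a..b}) = ennreal K"
    if "(h has_integral K) {a..b}" "\<And>x. 0 \<le> h x" for h :: "real \<Rightarrow> real" and K a b
    using nn_integral_has_integral_lebesgue'[OF that(2,1)]
    by (simp add: nn_integral_restrict_space nn_integral_completion)
  have "(\<integral>\<^sup>+x. ennreal (f' x) \<partial>lebesgue_on {c..d}) \<le> (\<integral>\<^sup>+x. ennreal (g' x) \<partial>lebesgue_on {-r..r})"
  proof (rule nn_integral_le_of_superlevel_le[OF sf sf f'm g'm])
    fix s :: real assume "s \<ge> 0"
    define A where "A = {x \<in> {c..d}. s < f' x}"
    define B where "B = {x \<in> {-r..r}. s < g' x}"
    have A: "A \<in> lmeasurable" unfolding A_def by (rule lmeasurable_superlevel[OF _ f'm]) simp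
    have B: "B \<in> lmeasurable" unfolding B_def by (rule lmeasurable_superlevel[OF _ g'm]) simp
    define m where "m = measure lebesgue A"
    have "m \<le> measure lebesgue {c..d}"
      unfolding m_def using fmeasurableD[OF A] by (intro measure_mono_fmeasurable) (auto simp: A_def)
    then have m: "m \<le> 2 * r" "0 \<le> m" using cd r by (auto simp: m_def)
    have "A \<subseteq> {x \<in> {-p..p}. s < f x}"
      using cd \<open>s \<ge> 0\<close> by (auto simp: A_def f'_def)
    then have m2: "m \<le> measure lebesgue {x \<in> {-p..p}. s < f x}"
      unfolding m_def using fmeasurableD[OF A] lmeasurable_superlevel[OF X(1) f]
      by (rule measure_mono_fmeasurable)
    have inB: "x \<in> B" if "x \<in> {-(m/2)<..<m/2}" "x \<noteq> 0"
      "\<bar>symmetric_decreasing_rearrangement {-p..p} f x\<bar> \<noteq> \<infinity>" for x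
    proof -
      have x: "0 < \<bar>x\<bar>" "2 * \<bar>x\<bar> < m" using that by auto
      have "ereal s < symmetric_decreasing_rearrangement {-p..p} f x"
        unfolding symmetric_decreasing_rearrangement_def
        by (rule decreasing_rearrangement_greater[OF X(1) f]) (use X(2) m m2 x r in linarith)+
      with that(3) have "s < g x" unfolding g_def
        by (cases "symmetric_decreasing_rearrangement {-p..p} f x") auto
      moreover have "x \<in> {-r..r}" using x m by auto
      ultimately show ?thesis by (simp add: B_def g'_def)
    qed
    have "AE x in lebesgue. x \<in> {-p<..<p} \<longrightarrow>
             \<bar>symmetric_decreasing_rearrangement {-p..p} f x\<bar> \<noteq> \<infinity>"
      using finite by (subst (asm) AE_restrict_space_iff) auto
    moreover have "AE x in lebesgue. x \<noteq> (0::real)"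
      by (intro AE_completion AE_lborel_singleton)
    ultimately have "AE x in lebesgue. x \<in> {-(m/2)<..<m/2} \<longrightarrow> x \<in> B"
      by eventually_elim (use inB m r in auto)
    then have "emeasure lebesgue {-(m/2)<..<m/2} \<le> emeasure lebesgue B"
      using fmeasurableD[OF B] by (rule emeasure_mono_AE)
    also have "emeasure lebesgue {-(m/2)<..<m/2} = ennreal m"
      using m by simp
    also have "ennreal m = emeasure lebesgue A"
      using A by (simp add: m_def emeasure_eq_measure2 del: emeasure_completion)
    finally have "emeasure lebesgue A \<le> emeasure lebesgue B" .
    moreover have "emeasure (lebesgue_on {c..d}) A = emeasure lebesgue A"
      by (rule emeasure_restrict_space) (auto simp: A_def)
    moreover have "emeasure (lebesgue_on {-r..r}) B = emeasure lebesgue B"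
      by (rule emeasure_restrict_space) (auto simp: B_def)
    ultimately show "emeasure (lebesgue_on {c..d}) {x \<in> space (lebesgue_on {c..d}). s < f' x}
        \<le> emeasure (lebesgue_on {-r..r}) {x \<in> space (lebesgue_on {-r..r}). s < g' x}"
      unfolding A_def B_def space_restrict_space by simp
  qed
  then have "ennreal I \<le> ennreal J"
    using nnI[OF I'] nnI[OF J'] by (simp add: f'_def g'_def)
  moreover show "0 \<le> J" using J' by (rule has_integral_nonneg) (simp add: g'_def)
  ultimately show "I \<le> J" by simp
qed

section \<open>Comparison of the two Poisson problems\<close>
text \<open>The solution enters the argument only through its slope \<open>w\<close>, whose drop over an interval is
  the integral of the right-hand side. Since the equation holds almost everywhere with a real second
  derivative, the right-hand side is finite almost everywhere.\<close>

lemma solves_poisson_dirichletE: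
  assumes "solves_poisson_dirichlet a b G u"
  obtains w where
    "\<And>x. x \<in> {a..b} \<Longrightarrow> (u has_real_derivative w x) (at x within {a..b})"
    "\<And>c d. a \<le> c \<Longrightarrow> c \<le> d \<Longrightarrow> d \<le> b \<Longrightarrow>
       ((\<lambda>x. real_of_ereal (G x)) has_integral w c - w d) {c..d}"
    "AE x in lebesgue_on {a<..<b}. \<bar>G x\<bar> \<noteq> \<infinity>"
    "u a = 0" "u b = 0"
proof -
  from assms obtain w where
    der: "\<forall>x\<in>{a..b}. (u has_real_derivative w x) (at x within {a..b})" and
    ac: "absolutely_continuous_fun a b w" and
    ae: "AE x in lebesgue_on {a<..<b}. \<exists>d. (w has_real_derivative d) (at x) \<and> ereal (- d) = G x" and
    bd: "u a = 0" "u b = 0"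
    unfolding solves_poisson_dirichlet_def by blast
  define N where "N = {x. \<not> (x \<in> {a<..<b} \<longrightarrow>
    (\<exists>d. (w has_real_derivative d) (at x) \<and> ereal (- d) = G x))} \<union> {a, b}"
  have "AE x in lebesgue. x \<in> {a<..<b} \<longrightarrow>
    (\<exists>d. (w has_real_derivative d) (at x) \<and> ereal (- d) = G x)"
    using ae by (subst (asm) AE_restrict_space_iff) auto
  then have ae_null: "negligible {x. \<not> (x \<in> {a<..<b} \<longrightarrow>
    (\<exists>d. (w has_real_derivative d) (at x) \<and> ereal (- d) = G x))}"
    unfolding completion.AE_iff_null_sets negligible_iff_null_sets by simp
  have N: "negligible N"
    unfolding N_def by (rule negligible_Un[OF ae_null negligible_finite]) simp
  show ?thesis
  proof (rule that[of w])
    fix c d assume cd: "a \<le> c" "c \<le> d" "d \<le> b"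
    have "((\<lambda>x. - real_of_ereal (G x)) has_integral w d - w c) {c..d}"
    proof (rule absolutely_continuous_fun_has_integral[OF cd(2) _ N])
      show "absolutely_continuous_fun c d w"
        using absolutely_continuous_fun_subinterval[OF ac cd(1,3)] .
      fix x assume x: "x \<in> {c..d} - N"
      then have "x \<in> {a<..<b}" using cd by (auto simp: N_def)
      with x obtain e where "(w has_real_derivative e) (at x)" "ereal (- e) = G x"
        by (auto simp: N_def)
      moreover from this(2) have "- real_of_ereal (G x) = e" by (cases "G x") auto
      ultimately show "(w has_real_derivative - real_of_ereal (G x)) (at x within {c..d})"
        by (simp add: has_field_derivative_at_within)
    qed
    from has_integral_neg[OF this] show "((\<lambda>x. real_of_ereal (G x)) has_integral w c - w d) {c..d}"
      by simp
  next
    show "AE x in lebesgue_on {a<..<b}. \<bar>G x\<bar> \<noteq> \<infinity>"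
      using ae by (rule eventually_mono) (metis PInfty_neq_ereal(2) MInfty_neq_ereal(2) abs_ereal.simps(1))
  qed (use der bd in auto)
qed

text \<open>An even second derivative makes \<open>w x + w (- x)\<close> constant, so \<open>v x - v (- x)\<close> is linear in \<open>x\<close>.
  It vanishes at \<open>0\<close> and at \<open>p\<close>, hence everywhere.\<close>

lemma even_potential:
  fixes v w g :: "real \<Rightarrow> real"
  assumes "p > 0"
    and der: "\<And>x. x \<in> {-p..p} \<Longrightarrow> (v has_real_derivative w x) (at x within {-p..p})"
    and int: "\<And>c d. -p \<le> c \<Longrightarrow> c \<le> d \<Longrightarrow> d \<le> p \<Longrightarrow> (g has_integral w c - w d) {c..d}"
    and even: "\<And>x. g (- x) = g x" and bd: "v (-p) = v p"
    and x: "x \<in> {-p..p}"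
  shows "w (- x) = - w x" "v (- x) = v x"
proof -
  have sum_w: "w x + w (- x) = 2 * w 0" if "0 \<le> x" "x \<le> p" for x
  proof -
    have "((\<lambda>y. g (- y)) has_integral w (- x) - w 0) {0..x}"
      using int[of "- x" 0] that has_integral_reflect_real[where f=g and a="- x" and b=0] by simp
    with int[of 0 x] that have "w 0 - w x = w (- x) - w 0"
      by (intro has_integral_unique[of g]) (auto simp: even)
    then show ?thesis by simp
  qed
  then have sum_w': "w x + w (- x) = 2 * w 0" if "x \<in> {-p..p}" for x
    using sum_w[of x] sum_w[of "- x"] that by (cases "x \<ge> 0") auto
  have der_refl: "((\<lambda>y. v (- y)) has_real_derivative - w (- x)) (at x within {-p..p})"
    if "x \<in> {-p..p}" for x
  proof -
    have "(v has_real_derivative w (- x)) (at (- x) within uminus ` {-p..p})"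
      using der[of "- x"] that by simp
    moreover have "(uminus has_real_derivative - 1) (at x within {-p..p})"
      by (rule derivative_eq_intros refl)+
    ultimately show ?thesis
      using DERIV_image_chain[of v "w (- x)" uminus x "{-p..p}" "-1"] by (simp add: o_def)
  qed
  \<comment> \<open>Twice the odd part of \<open>v\<close> minus the linear function that it has to be.\<close>
  define D where "D y = v y - v (- y) - 2 * w 0 * y" for y
  have D: "(D has_real_derivative 0) (at y within {-p..p})" if "y \<in> {-p..p}" for y
    unfolding D_def using that der[OF that] der_refl[OF that] sum_w'[OF that]
    by (auto intro!: derivative_eq_intros)
  have const: "D y = D (-p)" if "y \<in> {-p..p}" for y
  proof (rule DERIV_isconst2[of "-p" p])
    show "continuous_on {-p..p} D"
      using D by (rule DERIV_continuous_on)
    show "DERIV D z :> 0" if "-p < z" "z < p" for z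
      using D[of z] that by (simp add: at_within_Icc_at)
  qed (use that \<open>p > 0\<close> in auto)
  have "w 0 = 0"
    using const[of p] \<open>p > 0\<close> bd by (simp add: D_def)
  moreover have "D 0 = 0" by (simp add: D_def)
  ultimately show "w (- x) = - w x" "v (- x) = v x"
    using sum_w'[OF x] const[OF x] const[of 0] \<open>p > 0\<close> by (auto simp: D_def)
qed

text \<open>This is the heart of the comparison. Shrink \<open>[-p, p]\<close> linearly to \<open>[a, b]\<close> through intervals
  \<open>[\<alpha> t, \<beta> t]\<close>. The two end points move at the constant speeds \<open>p + a\<close> and \<open>p - b\<close>; weighting the
  value of \<open>u\<close> at each of them with the speed of the other makes the derivative of the weighted sum a
  multiple of the drop \<open>wu (\<alpha> t) - wu (\<beta> t)\<close>, which \<open>slope\<close> bounds by \<open>- 2 * wv (\<rho> t)\<close>, the drop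
  of \<open>wv\<close> over the centred interval of the same length if \<open>wv\<close> is odd. The half length \<open>\<rho> t\<close> also moves linearly, at the speed
  \<open>L / 2\<close>, where \<open>L = (p - b) + (p + a)\<close>. The remaining gap between the coefficients is the inequality
  \<open>4 (p - b) (p + a) \<le> L\<^sup>2\<close> of arithmetic and geometric means.\<close>

lemma weighted_endpoint_comparison:
  fixes u v wu wv :: "real \<Rightarrow> real"
  assumes du: "\<And>x. x \<in> {-p..p} \<Longrightarrow> (u has_real_derivative wu x) (at x within {-p..p})"
    and dv: "\<And>x. x \<in> {-p..p} \<Longrightarrow> (v has_real_derivative wv x) (at x within {-p..p})"
    and bd: "u (-p) = 0" "u p = 0" "v p = 0"
    and slope: "\<And>c d. -p \<le> c \<Longrightarrow> c \<le> d \<Longrightarrow> d \<le> p \<Longrightarrow> wu c - wu d \<le> - 2 * wv ((d - c) / 2)"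
    and neg: "\<And>x. 0 \<le> x \<Longrightarrow> x \<le> p \<Longrightarrow> wv x \<le> 0"
    and ab: "-p \<le> a" "a \<le> b" "b \<le> p"
  shows "(p - b) * u a + (p + a) * u b \<le> (2 * p - (b - a)) * v ((b - a) / 2)"
proof -
  define L where "L = 2 * p - (b - a)"
  define \<alpha> \<beta> \<rho> where "\<alpha> t = -p + t * (p + a)" and "\<beta> t = p - t * (p - b)" and "\<rho> t = p - t * (L / 2)" for t
  have half: "(\<beta> t - \<alpha> t) / 2 = \<rho> t" for t
    by (simp add: \<alpha>_def \<beta>_def \<rho>_def L_def algebra_simps diff_divide_distrib add_divide_distrib)
  have rng: "-p \<le> \<alpha> t" "\<alpha> t \<le> a" "b \<le> \<beta> t" "\<beta> t \<le> p" if "t \<in> {0..1}" for t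
  proof -
    have "0 \<le> t * (p + a)" "t * (p + a) \<le> 1 * (p + a)" "0 \<le> t * (p - b)" "t * (p - b) \<le> 1 * (p - b)"
      using that ab mult_right_mono[of t 1 "p + a"] mult_right_mono[of t 1 "p - b"] by auto
    then show "-p \<le> \<alpha> t" "\<alpha> t \<le> a" "b \<le> \<beta> t" "\<beta> t \<le> p" by (auto simp: \<alpha>_def \<beta>_def)
  qed
  have ord: "\<alpha> t \<le> \<beta> t" if "t \<in> {0..1}" for t using rng[OF that] ab by linarith
  have rho: "0 \<le> \<rho> t" "\<rho> t \<le> p" if "t \<in> {0..1}" for t
    using rng[OF that] ord[OF that] unfolding half[symmetric] by auto
  have inside: "\<alpha> ` {0..1} \<subseteq> {-p..p}" "\<beta> ` {0..1} \<subseteq> {-p..p}" "\<rho> ` {0..1} \<subseteq> {-p..p}"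
    using rng rho ab by (force simp del: atLeastAtMost_iff simp: image_subset_iff atLeastAtMost_iff[of _ "-p" p])+
  have chain: "((\<lambda>t. f (h t)) has_real_derivative f' (h t) * k) (at t within {0..1})"
    if "\<And>x. x \<in> {-p..p} \<Longrightarrow> (f has_real_derivative f' x) (at x within {-p..p})"
      and "h ` {0..1} \<subseteq> {-p..p}" and "(h has_real_derivative k) (at t within {0..1})" and "t \<in> {0..1}"
    for f f' h :: "real \<Rightarrow> real" and k t
  proof -
    have "(f has_real_derivative f' (h t)) (at (h t) within h ` {0..1})"
      using that(2,4) by (intro DERIV_subset[OF that(1) that(2)]) blast
    from DERIV_image_chain[OF this that(3)] show ?thesis by (simp add: o_def)
  qed
  \<comment> \<open>Left side minus right side of the claim for the interval at time \<open>t\<close>: \<open>H\<close> vanishes at \<open>0\<close>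
    and decreases.\<close>
  define H where "H t = (p - b) * u (\<alpha> t) + (p + a) * u (\<beta> t) - L * v (\<rho> t)" for t
  define H' where "H' t = (p - b) * (p + a) * (wu (\<alpha> t) - wu (\<beta> t)) + L\<^sup>2 / 2 * wv (\<rho> t)" for t
  have H: "(H has_real_derivative H' t) (at t within {0..1})" if t: "t \<in> {0..1}" for t
  proof -
    have "(\<alpha> has_real_derivative (p + a)) (at t within {0..1})"
      unfolding \<alpha>_def by (auto intro!: derivative_eq_intros)
    from chain[OF du inside(1) this t]
    have 1: "((\<lambda>t. u (\<alpha> t)) has_real_derivative wu (\<alpha> t) * (p + a)) (at t within {0..1})" .
    have "(\<beta> has_real_derivative (- (p - b))) (at t within {0..1})"
      unfolding \<beta>_def by (auto intro!: derivative_eq_intros)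
    from chain[OF du inside(2) this t]
    have 2: "((\<lambda>t. u (\<beta> t)) has_real_derivative wu (\<beta> t) * (- (p - b))) (at t within {0..1})" .
    have "(\<rho> has_real_derivative (- (L / 2))) (at t within {0..1})"
      unfolding \<rho>_def by (auto intro!: derivative_eq_intros)
    from chain[OF dv inside(3) this t]
    have 3: "((\<lambda>t. v (\<rho> t)) has_real_derivative wv (\<rho> t) * (- (L / 2))) (at t within {0..1})" .
    show ?thesis unfolding H_def H'_def
      by (auto intro!: derivative_eq_intros 1 2 3 simp: algebra_simps power2_eq_square)
  qed
  have H'_nonpos: "H' t \<le> 0" if t: "t \<in> {0..1}" for t
  proof -
    have "4 * ((p - b) * (p + a)) \<le> L\<^sup>2"
      using zero_le_power2[of "(p - b) - (p + a)"]
      by (simp add: L_def power2_eq_square algebra_simps)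
    then have amgm: "(p - b) * (p + a) \<le> L\<^sup>2 / 4" by simp
    have "wu (\<alpha> t) - wu (\<beta> t) \<le> - 2 * wv (\<rho> t)"
      using slope[of "\<alpha> t" "\<beta> t"] rng[OF t] ord[OF t] by (simp add: half)
    then have "(p - b) * (p + a) * (wu (\<alpha> t) - wu (\<beta> t)) \<le> (p - b) * (p + a) * (- 2 * wv (\<rho> t))"
      using ab by (intro mult_left_mono) auto
    also have "\<dots> \<le> L\<^sup>2 / 4 * (- 2 * wv (\<rho> t))"
      using amgm neg[OF rho[OF t]] by (intro mult_right_mono) auto
    finally show ?thesis by (simp add: H'_def algebra_simps)
  qed
  have "H 1 \<le> H 0"
  proof (rule DERIV_nonpos_imp_decreasing_open[of 0 1 H])
    show "continuous_on {0..1} H" using H by (rule DERIV_continuous_on)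
    show "\<exists>y. DERIV H t :> y \<and> y \<le> 0" if "0 < t" "t < 1" for t
      using H[of t] H'_nonpos[of t] that by (auto simp: at_within_Icc_at)
  qed simp
  moreover have "H 0 = 0" by (simp add: H_def \<alpha>_def \<beta>_def \<rho>_def bd)
  moreover have "\<alpha> 1 = a" "\<beta> 1 = b" by (simp_all add: \<alpha>_def \<beta>_def)
  moreover from this have "\<rho> 1 = (b - a) / 2" using half[of 1] by simp
  ultimately show ?thesis by (simp add: H_def L_def)
qed

lemma emeasure_le_of_differences_le:
  fixes A :: "real set"
  assumes A: "A \<in> sets lebesgue" "bounded A"
    and M: "0 \<le> M" "\<And>a b. a \<in> A \<Longrightarrow> b \<in> A \<Longrightarrow> a \<le> b \<Longrightarrow> b - a \<le> M"
  shows "emeasure lebesgue A \<le> ennreal M"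
proof (cases "A = {}")
  case False
  have bdd: "bdd_below A" "bdd_above A"
    using A(2) by (auto simp: bounded_imp_bdd_below bounded_imp_bdd_above)
  have "b - M \<le> a" if "a \<in> A" "b \<in> A" for a b
    using M(1) M(2)[OF that] by (cases "a \<le> b") auto
  then have "b - M \<le> Inf A" if "b \<in> A" for b
    using that False by (intro cInf_greatest) auto
  then have "Sup A \<le> Inf A + M"
    using False by (intro cSup_least) (auto simp: algebra_simps)
  moreover have "Inf A \<le> Sup A"
    using False bdd by (intro cInf_le_cSup)
  moreover have "emeasure lebesgue A \<le> emeasure lebesgue {Inf A..Sup A}"
    using bdd by (intro emeasure_mono) (auto intro: cInf_lower cSup_upper)
  ultimately show ?thesis
    by (auto intro: order.trans ennreal_leI)
qed simp

theorem corollary3p1: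
  fixes f u v \<phi> :: "real \<Rightarrow> real"
  assumes "integrable (lebesgue_on {-pi..pi}) f"
    and "AE x in lebesgue_on {-pi..pi}. 0 \<le> f x"
    and "solves_poisson_dirichlet (-pi) pi (\<lambda>x. ereal (f x)) u"
    and "solves_poisson_dirichlet (-pi) pi (symmetric_decreasing_rearrangement {-pi..pi} f) v"
    and "mono \<phi>"
    and "convex_on UNIV \<phi>"
  shows "(LINT x|lebesgue_on {-pi..pi}. \<phi> (u x)) \<le> (LINT x|lebesgue_on {-pi..pi}. \<phi> (v x))"
proof -
  define g where "g x = real_of_ereal (symmetric_decreasing_rearrangement {-pi..pi} f x)" for x
  obtain wu where
    du: "\<And>x. x \<in> {-pi..pi} \<Longrightarrow> (u has_real_derivative wu x) (at x within {-pi..pi})" and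
    fint: "\<And>c d. -pi \<le> c \<Longrightarrow> c \<le> d \<Longrightarrow> d \<le> pi \<Longrightarrow> (f has_integral wu c - wu d) {c..d}" and
    ubd: "u (-pi) = 0" "u pi = 0"
    using solves_poisson_dirichletE[OF assms(3)] unfolding real_of_ereal.simps by metis
  obtain wv where
    dv: "\<And>x. x \<in> {-pi..pi} \<Longrightarrow> (v has_real_derivative wv x) (at x within {-pi..pi})" and
    gint: "\<And>c d. -pi \<le> c \<Longrightarrow> c \<le> d \<Longrightarrow> d \<le> pi \<Longrightarrow> (g has_integral wv c - wv d) {c..d}" and
    fin: "AE x in lebesgue_on {-pi<..<pi}.
      \<bar>symmetric_decreasing_rearrangement {-pi..pi} f x\<bar> \<noteq> \<infinity>" and
    vbd: "v (-pi) = 0" "v pi = 0"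
    using solves_poisson_dirichletE[OF assms(4)] unfolding g_def by metis
  have g_even: "g (- x) = g x" for x
    by (simp add: g_def symmetric_decreasing_rearrangement_def)
  have wv_odd: "wv (- x) = - wv x" and v_even: "v (- x) = v x" if "x \<in> {-pi..pi}" for x
    using even_potential[OF pi_gt_zero dv gint g_even _ that] vbd by auto
  have slope: "wu c - wu d \<le> - 2 * wv ((d - c) / 2)" and wv_neg: "wv ((d - c) / 2) \<le> 0"
    if cd: "-pi \<le> c" "c \<le> d" "d \<le> pi" for c d
  proof -
    define r where "r = (d - c) / 2"
    have r: "0 \<le> r" "r \<le> pi" using cd by (auto simp: r_def)
    have J: "(g has_integral wv (- r) - wv r) {-r..r}" using gint[of "- r" r] r by simp
    have odd: "wv (- r) = - wv r" using wv_odd[of r] r by simp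
    note hl = integral_le_integral_symmetric_decreasing_rearrangement
      [OF borel_measurable_integrable[OF assms(1)] assms(2) fin cd fint[OF cd] J[unfolded g_def r_def]]
    from hl show "wu c - wu d \<le> - 2 * wv ((d - c) / 2)" and "wv ((d - c) / 2) \<le> 0"
      using odd by (auto simp: r_def)
  qed
  have neg: "wv x \<le> 0" if "0 \<le> x" "x \<le> pi" for x
    using wv_neg[of "- x" x] that by simp
  \<comment> \<open>The weights in the comparison of end points sum to \<open>2 * pi - (b - a)\<close>, so the weighted mean of
    \<open>u a\<close> and \<open>u b\<close> is bounded by \<open>v\<close>, and the smaller of the two values all the more. When the
    weights vanish, \<open>a\<close> and \<open>b\<close> are the boundary points.\<close>
  have min_le: "min (u a) (u b) \<le> v ((b - a) / 2)" if ab: "-pi \<le> a" "a \<le> b" "b \<le> pi" for a b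
  proof (cases "a = -pi \<and> b = pi")
    case True
    then show ?thesis using ubd vbd by simp
  next
    case False
    then have L: "0 < 2 * pi - (b - a)" using ab by linarith
    have "(2 * pi - (b - a)) * min (u a) (u b) = (pi - b) * min (u a) (u b) + (pi + a) * min (u a) (u b)"
      by (simp add: algebra_simps)
    also have "\<dots> \<le> (pi - b) * u a + (pi + a) * u b"
      using ab by (intro add_mono mult_left_mono) auto
    also have "\<dots> \<le> (2 * pi - (b - a)) * v ((b - a) / 2)"
      by (rule weighted_endpoint_comparison[OF du dv ubd vbd(2) slope neg ab])
    finally show ?thesis using L by (simp add: mult_le_cancel_left)
  qed
  have u_cont: "continuous_on {-pi..pi} u"
    using du by (rule DERIV_continuous_on)
  have v_cont: "continuous_on {-pi..pi} v"
    using dv by (rule DERIV_continuous_on)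
  have v_anti: "v y \<le> v x" if "0 \<le> x" "x \<le> y" "y \<le> pi" for x y
  proof (rule DERIV_nonpos_imp_decreasing_open[OF that(2)])
    show "\<exists>z. DERIV v t :> z \<and> z \<le> 0" if t: "x < t" "t < y" for t
      using dv[of t] neg[of t] t \<open>0 \<le> x\<close> \<open>y \<le> pi\<close> by (auto simp: at_within_Icc_at intro!: exI[of _ "wv t"])
    show "continuous_on {x..y} v" using that by (intro continuous_on_subset[OF v_cont]) auto
  qed
  have v_ge: "v r \<le> v x" if "x \<in> {-r..r}" "r \<le> pi" for x r
    using v_anti[of "\<bar>x\<bar>" r] v_even[of x] that by (cases "x \<ge> 0") auto
  have phi_m: "(\<lambda>x. \<phi> (h x)) \<in> borel_measurable (lebesgue_on {-pi..pi})"
    if "continuous_on {-pi..pi} h" for h :: "real \<Rightarrow> real"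
    using borel_measurable_mono[OF assms(5)] continuous_imp_measurable_on_sets_lebesgue[OF that]
    by (rule measurable_compose[rotated]) auto
  \<comment> \<open>If \<open>a \<le> b\<close> lie in the superlevel set of \<open>\<phi> \<circ> u\<close>, then the centred interval of length \<open>b - a\<close>
    lies in that of \<open>\<phi> \<circ> v\<close>. So the latter is at least as long as the diameter of the former.\<close>
  have superlevel: "emeasure lebesgue {x \<in> {-pi..pi}. s < \<phi> (u x)}
      \<le> emeasure lebesgue {x \<in> {-pi..pi}. s < \<phi> (v x)}" (is "emeasure _ ?A \<le> emeasure _ ?B") for s
  proof -
    have A: "?A \<in> lmeasurable" by (rule lmeasurable_superlevel[OF _ phi_m[OF u_cont]]) simp
    have B: "?B \<in> lmeasurable" by (rule lmeasurable_superlevel[OF _ phi_m[OF v_cont]]) simp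
    have "emeasure lebesgue ?A \<le> ennreal (measure lebesgue ?B)"
    proof (rule emeasure_le_of_differences_le)
      show "bounded ?A" by (rule bounded_subset[of "{-pi..pi}"]) auto
      fix a b assume ab: "a \<in> ?A" "b \<in> ?A" "a \<le> b"
      define r where "r = (b - a) / 2"
      have "s < \<phi> (min (u a) (u b))" using ab by (simp add: min_def)
      also have "\<dots> \<le> \<phi> (v r)"
        using ab unfolding r_def by (intro monoD[OF assms(5)] min_le) auto
      finally have "s < \<phi> (v r)" .
      have "x \<in> ?B" if "x \<in> {-r..r}" for x
      proof -
        have "v r \<le> v x" using ab that by (intro v_ge) (auto simp: r_def)
        with \<open>s < \<phi> (v r)\<close> have "s < \<phi> (v x)" using monoD[OF assms(5)] by (meson less_le_trans)
        moreover have "-pi \<le> a" "b \<le> pi" using ab by auto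
        then have "-pi \<le> - r" "r \<le> pi" by (auto simp: r_def)
        ultimately show ?thesis using that by auto
      qed
      then have "measure lebesgue {-r..r} \<le> measure lebesgue ?B"
        using B by (intro measure_mono_fmeasurable) auto
      moreover have "0 \<le> r" "b - a = r + r" using ab(3) by (auto simp: r_def)
      ultimately show "b - a \<le> measure lebesgue ?B" by simp
    qed (use fmeasurableD[OF A] in auto)
    also have "\<dots> = emeasure lebesgue ?B"
      using B by (simp add: emeasure_eq_measure2 del: emeasure_completion)
    finally show ?thesis .
  qed
  have "bounded (u ` {-pi..pi} \<union> v ` {-pi..pi})"
    using u_cont v_cont by (intro compact_imp_bounded compact_Un compact_continuous_image) auto
  then obtain K where K: "\<And>x. x \<in> {-pi..pi} \<Longrightarrow> \<bar>u x\<bar> \<le> K \<and> \<bar>v x\<bar> \<le> K"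
    unfolding bounded_iff real_norm_def by blast
  have phi_bds: "\<phi> (-K) \<le> \<phi> y" "\<phi> y \<le> \<phi> K" if "\<bar>y\<bar> \<le> K" for y
    using that by (auto intro!: monoD[OF assms(5)])
  interpret finite_measure "lebesgue_on {-pi..pi}"
    by (rule finite_measure_lebesgue_on) simp
  have int: "integrable (lebesgue_on {-pi..pi}) (\<lambda>x. \<phi> (h x))"
    if h: "continuous_on {-pi..pi} h" "\<And>x. x \<in> {-pi..pi} \<Longrightarrow> \<bar>h x\<bar> \<le> K" for h :: "real \<Rightarrow> real"
  proof (rule integrable_const_bound[OF _ phi_m[OF h(1)]])
    have "\<bar>\<phi> (h x)\<bar> \<le> \<bar>\<phi> K\<bar> + \<bar>\<phi> (-K)\<bar>" if "x \<in> {-pi..pi}" for x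
      using phi_bds[OF h(2)[OF that]] by linarith
    then show "AE x in lebesgue_on {-pi..pi}. norm (\<phi> (h x)) \<le> \<bar>\<phi> K\<bar> + \<bar>\<phi> (-K)\<bar>"
      by (intro AE_I2) simp
  qed
  have int_u: "integrable (lebesgue_on {-pi..pi}) (\<lambda>x. \<phi> (u x))"
    and int_v: "integrable (lebesgue_on {-pi..pi}) (\<lambda>x. \<phi> (v x))"
    using int u_cont v_cont K by auto
  \<comment> \<open>Slicing needs nonnegative functions, and \<open>\<phi>\<close> may be negative; a common lower bound is subtracted.\<close>
  let ?C = "\<phi> (-K)"
  have "(\<integral>\<^sup>+x. ennreal (\<phi> (u x) - ?C) \<partial>lebesgue_on {-pi..pi})
      \<le> (\<integral>\<^sup>+x. ennreal (\<phi> (v x) - ?C) \<partial>lebesgue_on {-pi..pi})"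
  proof (rule nn_integral_le_of_superlevel_le)
    fix s :: real
    have restrict: "emeasure (lebesgue_on {-pi..pi}) {x \<in> space (lebesgue_on {-pi..pi}). s < \<phi> (h x) - ?C}
        = emeasure lebesgue {x \<in> {-pi..pi}. s + ?C < \<phi> (h x)}" for h :: "real \<Rightarrow> real"
    proof -
      have "{x \<in> space (lebesgue_on {-pi..pi}). s < \<phi> (h x) - ?C} = {x \<in> {-pi..pi}. s + ?C < \<phi> (h x)}"
        by (simp add: less_diff_eq)
      then show ?thesis by (simp only:) (rule emeasure_restrict_space, auto)
    qed
    show "emeasure (lebesgue_on {-pi..pi}) {x \<in> space (lebesgue_on {-pi..pi}). s < \<phi> (u x) - ?C}
        \<le> emeasure (lebesgue_on {-pi..pi}) {x \<in> space (lebesgue_on {-pi..pi}). s < \<phi> (v x) - ?C}"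
      unfolding restrict by (rule superlevel)
  qed (intro borel_measurable_diff phi_m u_cont v_cont borel_measurable_const sigma_finite_measure_axioms)+
  moreover have "(\<integral>\<^sup>+x. ennreal (\<phi> (h x) - ?C) \<partial>lebesgue_on {-pi..pi})
      = ennreal (LINT x|lebesgue_on {-pi..pi}. \<phi> (h x) - ?C)"
    if "continuous_on {-pi..pi} h" "\<And>x. x \<in> {-pi..pi} \<Longrightarrow> \<bar>h x\<bar> \<le> K" for h :: "real \<Rightarrow> real"
  proof (rule nn_integral_eq_integral)
    show "integrable (lebesgue_on {-pi..pi}) (\<lambda>x. \<phi> (h x) - ?C)"
      using int[OF that] by simp
    show "AE x in lebesgue_on {-pi..pi}. 0 \<le> \<phi> (h x) - ?C"
      using phi_bds(1)[OF that(2)] by (intro AE_I2) simp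
  qed
  ultimately have "ennreal (LINT x|lebesgue_on {-pi..pi}. \<phi> (u x) - ?C)
      \<le> ennreal (LINT x|lebesgue_on {-pi..pi}. \<phi> (v x) - ?C)"
    using u_cont v_cont K by simp
  moreover have "0 \<le> (LINT x|lebesgue_on {-pi..pi}. \<phi> (v x) - ?C)"
    using K phi_bds by (intro Bochner_Integration.integral_nonneg) auto
  ultimately have "(LINT x|lebesgue_on {-pi..pi}. \<phi> (u x) - ?C)
      \<le> (LINT x|lebesgue_on {-pi..pi}. \<phi> (v x) - ?C)"
    by simp
  then show ?thesis using int_u int_v by simp
qed

end
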